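(* For all natural numbers $m,n\ge 1$ there exists an integer $K(m,n)$ (depending only on $m$ and $n$) such that for every closed subspace $X$ of $\mathbb R^m$, every continuous fixed-point free map $f:X\to \exp_n(\mathbb R^m)$ is colorable by at most $K(m,n)$ many bright colors.
   Context: For a topological space $Z$, $2^Z$ is the space of all non-empty closed subsets of $Z$ with the Vietoris topology, whose basic open sets are $\langle U_1,\dots,U_p\rangle=\{A\in 2^Z: A\subset U_1\cup\dots\cup U_p \text{ and } A\cap U_i\neq\emptyset \text{ for all } i\}$ with $U_1,\dots,U_p$ open in $Z$. $\exp_n(Z)$ is the subspace $\{A\in 2^Z: |A|\le n\}$. For $X\subset Z$, a map $f:X\to 2^Z$ is fixed-point free if $x\notin f(x)$ for every $x\in X$. A closed subset $F$ of $X$ is a bright color of $f$ if $F\cap \mathrm{cl}_Z\big(\bigcup\{f(x):x\in F\}\big)=\emptyset$. The map $f$ is colorable by at most $N$ bright colors if $X$ can be covered by at most $N$ bright colors of $f$. *)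

theory Defs
  imports "HOL-Analysis.Analysis"
begin

text \<open>The finite set \<open>\<U>\<close> plays the role of \<open>{U\<^sub>1, \<dots>, U\<^sub>p}\<close>; order and repetitions are immaterial.\<close>

definition vietoris_basic :: "'a topology \<Rightarrow> 'a set set \<Rightarrow> 'a set set" where
  "vietoris_basic Z \<U> =
     {A. closedin Z A \<and> A \<noteq> {} \<and> A \<subseteq> \<Union>\<U> \<and> (\<forall>U\<in>\<U>. A \<inter> U \<noteq> {})}"

definition vietoris :: "'a topology \<Rightarrow> 'a set topology" where
  "vietoris Z =
     topology_generated_by {vietoris_basic Z \<U> | \<U>. finite \<U> \<and> (\<forall>U\<in>\<U>. openin Z U)}"

text \<open>\<^const>\<open>topology_generated_by\<close> treats the basic sets only as a subbase; they do form a base: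
  see \<open>openin_vietoris_iff_base\<close>.\<close>

lemma vietoris_basic_Int:
  "vietoris_basic Z \<U> \<inter> vietoris_basic Z \<V> =
     vietoris_basic Z ((\<lambda>U. U \<inter> \<Union>\<V>) ` \<U> \<union> (\<lambda>V. V \<inter> \<Union>\<U>) ` \<V>)"
  (is "_ = vietoris_basic Z ?\<W>")
proof (rule set_eqI)
  fix A
  have un: "\<Union>?\<W> = \<Union>\<U> \<inter> \<Union>\<V>"
    by auto
  have meet: "(\<forall>W\<in>?\<W>. A \<inter> W \<noteq> {}) \<longleftrightarrow> (\<forall>U\<in>\<U>. A \<inter> U \<noteq> {}) \<and> (\<forall>V\<in>\<V>. A \<inter> V \<noteq> {})"
    if "A \<subseteq> \<Union>\<U> \<inter> \<Union>\<V>"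
  proof -
    have "A \<inter> (U \<inter> \<Union>\<V>) = A \<inter> U" "A \<inter> (U \<inter> \<Union>\<U>) = A \<inter> U" for U
      using that by auto
    then show ?thesis
      by (simp only: ball_Un ball_simps)
  qed
  show "A \<in> vietoris_basic Z \<U> \<inter> vietoris_basic Z \<V> \<longleftrightarrow> A \<in> vietoris_basic Z ?\<W>"
  proof (cases "A \<subseteq> \<Union>\<U> \<inter> \<Union>\<V>")
    case True
    then show ?thesis
      unfolding vietoris_basic_def Int_iff mem_Collect_eq un meet[OF True] by (simp only: Int_subset_iff, argo)
  next
    case False
    then show ?thesis
      unfolding vietoris_basic_def Int_iff mem_Collect_eq un by (simp only: Int_subset_iff, argo)
  qed
qed

lemma openin_vietoris_iff_base:
  "openin (vietoris Z) W \<longleftrightarrow>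
     (\<forall>A\<in>W. \<exists>\<U>. finite \<U> \<and> (\<forall>U\<in>\<U>. openin Z U) \<and>
        A \<in> vietoris_basic Z \<U> \<and> vietoris_basic Z \<U> \<subseteq> W)" (is "_ \<longleftrightarrow> ?base W")
proof
  let ?B = "{vietoris_basic Z \<U> | \<U>. finite \<U> \<and> (\<forall>U\<in>\<U>. openin Z U)}"
  assume "openin (vietoris Z) W"
  then have "generate_topology_on ?B W"
    by (simp add: vietoris_def openin_topology_generated_by_iff)
  then show "?base W"
  proof induction
    case Empty
    then show ?case by simp
  next
    case (Int S T)
    show ?case
    proof
      fix A assume A: "A \<in> S \<inter> T"
      from bspec[OF Int.IH(1) IntD1[OF A]] obtain \<U> where
        \<U>: "finite \<U>" "\<forall>U\<in>\<U>. openin Z U" "A \<in> vietoris_basic Z \<U>" "vietoris_basic Z \<U> \<subseteq> S"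
        by (elim exE conjE)
      from bspec[OF Int.IH(2) IntD2[OF A]] obtain \<V> where
        \<V>: "finite \<V>" "\<forall>V\<in>\<V>. openin Z V" "A \<in> vietoris_basic Z \<V>" "vietoris_basic Z \<V> \<subseteq> T"
        by (elim exE conjE)
      let ?\<W> = "(\<lambda>U. U \<inter> \<Union>\<V>) ` \<U> \<union> (\<lambda>V. V \<inter> \<Union>\<U>) ` \<V>"
      have "finite ?\<W>"
        using \<U> \<V> by simp
      moreover have "\<forall>W\<in>?\<W>. openin Z W"
        using \<U>(2) \<V>(2) by (auto intro!: openin_Int openin_Union)
      moreover have "A \<in> vietoris_basic Z ?\<W>"
        unfolding vietoris_basic_Int[symmetric] using \<U>(3) \<V>(3) by (rule IntI)
      moreover have "vietoris_basic Z ?\<W> \<subseteq> S \<inter> T"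
        unfolding vietoris_basic_Int[symmetric] using \<U>(4) \<V>(4) by (rule Int_mono)
      ultimately show "\<exists>\<U>. finite \<U> \<and> (\<forall>U\<in>\<U>. openin Z U) \<and>
          A \<in> vietoris_basic Z \<U> \<and> vietoris_basic Z \<U> \<subseteq> S \<inter> T"
        by (intro exI[of _ ?\<W>] conjI)
    qed
  next
    case (UN \<K>)
    show ?case
    proof
      fix A assume "A \<in> \<Union>\<K>"
      then obtain S where S: "S \<in> \<K>" "A \<in> S"
        by blast
      from bspec[OF UN.IH[OF S(1)] S(2)] obtain \<U> where
        "finite \<U>" "\<forall>U\<in>\<U>. openin Z U" "A \<in> vietoris_basic Z \<U>" "vietoris_basic Z \<U> \<subseteq> S"
        by (elim exE conjE)
      moreover have "S \<subseteq> \<Union>\<K>"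
        using S by blast
      ultimately show "\<exists>\<U>. finite \<U> \<and> (\<forall>U\<in>\<U>. openin Z U) \<and>
          A \<in> vietoris_basic Z \<U> \<and> vietoris_basic Z \<U> \<subseteq> \<Union>\<K>"
        by (meson order_trans)
    qed
  next
    case (Basis S)
    then show ?case by blast
  qed
next
  assume W: "?base W"
  show "openin (vietoris Z) W"
  proof (subst openin_subopen, intro ballI)
    fix A assume "A \<in> W"
    then obtain \<U> where \<U>: "finite \<U>" "\<forall>U\<in>\<U>. openin Z U" "A \<in> vietoris_basic Z \<U>" "vietoris_basic Z \<U> \<subseteq> W"
      using W by blast
    moreover have "openin (vietoris Z) (vietoris_basic Z \<U>)"
      unfolding vietoris_def by (rule topology_generated_by_Basis) (use \<U> in blast)
    ultimately show "\<exists>T. openin (vietoris Z) T \<and> A \<in> T \<and> T \<subseteq> W"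
      by blast
  qed
qed

lemma topspace_vietoris: "topspace (vietoris Z) = {A. closedin Z A \<and> A \<noteq> {}}"
proof
  show "topspace (vietoris Z) \<subseteq> {A. closedin Z A \<and> A \<noteq> {}}"
    by (auto simp: vietoris_def vietoris_basic_def)
  have "{A. closedin Z A \<and> A \<noteq> {}} \<subseteq> vietoris_basic Z {topspace Z}"
    by (auto simp: vietoris_basic_def dest: closedin_subset)
  moreover have "vietoris_basic Z {topspace Z} \<subseteq> topspace (vietoris Z)"
    unfolding vietoris_def topology_generated_by_topspace
    by (rule Union_upper) (auto intro!: exI[of _ "{topspace Z}"])
  ultimately show "{A. closedin Z A \<and> A \<noteq> {}} \<subseteq> topspace (vietoris Z)"
    by blast
qed

definition exp_space :: "nat \<Rightarrow> 'a topology \<Rightarrow> 'a set topology" where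
  "exp_space n Z = subtopology (vietoris Z) {A. finite A \<and> card A \<le> n}"

definition fixed_point_free_on :: "'a set \<Rightarrow> ('a \<Rightarrow> 'a set) \<Rightarrow> bool" where
  "fixed_point_free_on X f \<longleftrightarrow> (\<forall>x\<in>X. x \<notin> f x)"

definition bright_color :: "'a topology \<Rightarrow> 'a set \<Rightarrow> ('a \<Rightarrow> 'a set) \<Rightarrow> 'a set \<Rightarrow> bool" where
  "bright_color Z X f F \<longleftrightarrow>
     closedin (subtopology Z X) F \<and> F \<inter> (Z closure_of (\<Union>x\<in>F. f x)) = {}"

definition bright_colorable :: "'a topology \<Rightarrow> 'a set \<Rightarrow> ('a \<Rightarrow> 'a set) \<Rightarrow> nat \<Rightarrow> bool" where
  "bright_colorable Z X f N \<longleftrightarrow>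
     (\<exists>\<F>. finite \<F> \<and> card \<F> \<le> N \<and> (\<forall>F\<in>\<F>. bright_color Z X f F) \<and> X \<subseteq> \<Union>\<F>)"

end

theory Submission
  imports Defs "HOL-Real_Asymp.Real_Asymp"
begin

text \<open>View \<open>f\<close>, an upper semicontinuous map, as a directed graph of out-degree at most \<open>n\<close>. On a compact piece of \<open>X\<close> some finite colouring by open sets
  exists. A fine grid of cubes shrinks it so that each point lies in at most \<open>2 ^ m\<close> closed
  colours, whence \<open>f x\<close> meets at most \<open>r = n * 2 ^ m\<close> of them, and Linial's colour reduction for
  bounded out-degree turns \<open>2 ^ L\<close> colours into \<open>(2 * L) ^ r\<close>. Iterating, the number of colours
  drops below a constant that depends on \<open>m\<close> and \<open>n\<close> only. For unbounded \<open>X\<close>, choose radii growing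
  so fast that \<open>f\<close> maps each shell into the ball bounded by the next one. Among the shells of even
  index (and likewise of odd index) no arrow leads outwards, so they can be coloured one after the
  other.\<close>

section \<open>Shrinking a cover to overlap bounded by the dimension\<close>

text \<open>Cut space into small, slightly enlarged cubes and hand each one that meets
  \<open>A\<close> to a single \<open>G i\<close> containing it. Per coordinate only two grid
  positions are possible for a cube through a given point, so the overlap bound does not depend on
  \<open>I\<close>.\<close>

lemma bounded_order_shrinking:
  fixes A :: "(real ^ 'm) set" and G :: "'i \<Rightarrow> (real ^ 'm) set"
  assumes A: "compact A" and I: "finite I" and G: "\<And>i. i \<in> I \<Longrightarrow> open (G i)"
    and cover: "A \<subseteq> (\<Union>i\<in>I. G i)"
  obtains W D where "\<And>i. open (W i)" "\<And>i. closed (D i)" "\<And>i. D i \<subseteq> W i"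
    "\<And>i. i \<in> I \<Longrightarrow> closure (W i) \<subseteq> G i" "A \<subseteq> (\<Union>i\<in>I. D i)"
    "\<And>y. card {i \<in> I. y \<in> closure (W i)} \<le> 2 ^ CARD('m)"
proof -
  have "\<And>b. b \<in> G ` I \<Longrightarrow> open b"
    using G by auto
  from Heine_Borel_lemma[OF A _ this] cover
  obtain e where e: "e > 0" and lebesgue: "\<And>x. x \<in> A \<Longrightarrow> \<exists>b\<in>G ` I. ball x e \<subseteq> b"
    by metis
  \<comment> \<open>Two points of an enlarged cube differ by at most \<open>6/5 * d\<close> in each
    coordinate, so their distance is at most \<open>3/5 * e\<close>, below the Lebesgue number
    \<open>e\<close>.\<close>
  define d where "d = e / (2 * CARD('m))"
  have d: "d > 0"
    using e by (simp add: d_def)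
  \<comment> \<open>Cubes centred at the grid points \<open>d * z\<close>. With
    \<open>s = 1/2\<close> they tile the space; \<open>s = 3/5\<close> gives an overlap, yet still
    admits only two integers per coordinate.\<close>
  define Q :: "real \<Rightarrow> ('m \<Rightarrow> int) \<Rightarrow> (real ^ 'm) set"
    where "Q s z = {y. \<forall>k. \<bar>y $ k - d * z k\<bar> \<le> s * d}" for s z
  define O' :: "('m \<Rightarrow> int) \<Rightarrow> (real ^ 'm) set"
    where "O' z = {y. \<forall>k. \<bar>y $ k - d * z k\<bar> < 3/5 * d}" for z
  define Z where "Z = {z. Q (3/5) z \<inter> A \<noteq> {}}"
  have closed_Q: "closed (Q s z)" for s z
    unfolding Q_def by (intro closed_Collect_all closed_Collect_le continuous_intros)
  have open_O: "open (O' z)" for z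
  proof -
    have "O' z = (\<Inter>k. {y. \<bar>y $ k - d * z k\<bar> < 3/5 * d})"
      by (auto simp: O'_def)
    then show ?thesis
      by (auto intro!: open_INT open_Collect_less continuous_intros)
  qed
  have QO: "Q (1/2) z \<subseteq> O' z" for z
  proof -
    have "1/2 * d < 3/5 * d"
      using d by simp
    then show ?thesis
      unfolding Q_def O'_def by (blast intro: le_less_trans)
  qed
  have OQ: "O' z \<subseteq> Q (3/5) z" for z
    unfolding Q_def O'_def by (auto intro: less_imp_le)
  have "\<exists>i\<in>I. Q (3/5) z \<subseteq> G i" if z: "z \<in> Z" for z
  proof -
    obtain x where x: "x \<in> Q (3/5) z" "x \<in> A"
      using z unfolding Z_def by blast
    have "Q (3/5) z \<subseteq> ball x e"
    proof
      fix y assume y: "y \<in> Q (3/5) z"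
      have "\<bar>(x - y) $ k\<bar> \<le> 6/5 * d" for k
      proof -
        have "\<bar>x $ k - d * z k\<bar> \<le> 3/5 * d" "\<bar>y $ k - d * z k\<bar> \<le> 3/5 * d"
          using x y by (auto simp: Q_def)
        then show ?thesis
          unfolding vector_minus_component by linarith
      qed
      then have "(\<Sum>k\<in>UNIV. \<bar>(x - y) $ k\<bar>) \<le> CARD('m) * (6/5 * d)"
        by (intro sum_bounded_above)
      also have "\<dots> < e"
        using e by (simp add: d_def)
      finally show "y \<in> ball x e"
        using norm_le_l1_cart[of "x - y"] by (simp add: dist_norm)
    qed
    with lebesgue[OF x(2)] show ?thesis
      by blast
  qed
  then obtain c where c: "\<And>z. z \<in> Z \<Longrightarrow> c z \<in> I \<and> Q (3/5) z \<subseteq> G (c z)"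
    by metis
  obtain B where B: "\<And>x. x \<in> A \<Longrightarrow> norm x \<le> B"
    using compact_imp_bounded[OF A] by (auto simp: bounded_iff)
  \<comment> \<open>Boundedness of \<open>A\<close> confines the centres to a finite box; finiteness
    of \<open>Z\<close> makes the unions of closed cubes below closed.\<close>
  have "Z \<subseteq> Pi UNIV (\<lambda>_. {-\<lceil>B / d + 1\<rceil>..\<lceil>B / d + 1\<rceil>})"
  proof (intro subsetI Pi_I)
    fix z k assume "z \<in> Z"
    then obtain x where x: "x \<in> Q (3/5) z" "x \<in> A"
      unfolding Z_def by blast
    have "\<bar>x $ k\<bar> \<le> B"
      using B[OF x(2)] component_le_norm_cart[of x k] by linarith
    moreover have "\<bar>x $ k - d * z k\<bar> \<le> 3/5 * d"
      using x by (auto simp: Q_def)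
    ultimately have "\<bar>d * z k\<bar> \<le> B + d"
      using d by linarith
    then have "\<bar>real_of_int (z k)\<bar> \<le> B / d + 1"
      using d by (simp add: abs_mult field_simps)
    then show "z k \<in> {-\<lceil>B / d + 1\<rceil>..\<lceil>B / d + 1\<rceil>}"
      unfolding atLeastAtMost_iff by linarith
  qed
  moreover have "finite (Pi (UNIV::'m set) (\<lambda>_. {-\<lceil>B / d + 1\<rceil>..\<lceil>B / d + 1\<rceil>}))"
    by (subst PiE_UNIV_domain[symmetric], rule finite_PiE) simp_all
  ultimately have fin: "finite Z"
    by (rule finite_subset)
  define W where "W i = (\<Union>z\<in>{z\<in>Z. c z = i}. O' z)" for i
  define D where "D i = (\<Union>z\<in>{z\<in>Z. c z = i}. Q (1/2) z)" for i
  have clW: "closure (W i) \<subseteq> (\<Union>z\<in>{z\<in>Z. c z = i}. Q (3/5) z)" for i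
  proof (rule closure_minimal)
    show "closed (\<Union>z\<in>{z\<in>Z. c z = i}. Q (3/5) z)"
      using fin closed_Q by (intro closed_UN) auto
  qed (use OQ in \<open>force simp: W_def\<close>)
  show thesis
  proof
    show "open (W i)" for i
      using open_O by (auto simp: W_def)
    show "closed (D i)" for i
      unfolding D_def using fin closed_Q by (intro closed_UN) auto
    show "D i \<subseteq> W i" for i
      using QO by (force simp: W_def D_def)
    show "closure (W i) \<subseteq> G i" if "i \<in> I" for i
      using clW[of i] c by blast
    show "A \<subseteq> (\<Union>i\<in>I. D i)"
    proof
      fix x assume x: "x \<in> A"
      define z where "z k = round (x $ k / d)" for k
      have "\<bar>x $ k - d * z k\<bar> \<le> 1/2 * d" for k
      proof -
        have "\<bar>x $ k / d - z k\<bar> \<le> 1/2"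
          using of_int_round_abs_le[of "x $ k / d"] by (simp add: z_def abs_minus_commute)
        then have "d * \<bar>x $ k / d - z k\<bar> \<le> d * (1/2)"
          using d by (intro mult_left_mono) auto
        moreover have "d * \<bar>x $ k / d - z k\<bar> = \<bar>d * (x $ k / d - z k)\<bar>"
          using d by (simp add: abs_mult)
        ultimately show ?thesis
          using d by (simp add: right_diff_distrib)
      qed
      then have z: "x \<in> Q (1/2) z"
        by (simp add: Q_def)
      then have "z \<in> Z"
        using x QO OQ by (force simp: Z_def)
      then show "x \<in> (\<Union>i\<in>I. D i)"
        using z c by (auto simp: D_def)
    qed
    show "card {i \<in> I. y \<in> closure (W i)} \<le> 2 ^ CARD('m)" for y
    proof -
      \<comment> \<open>If the enlarged cube at \<open>z\<close> contains \<open>y\<close>, each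
        \<open>z k\<close> is one of the two integers listed; every counted \<open>i\<close> is
        \<open>c z\<close> for such a \<open>z\<close>.\<close>
      define P where "P = Pi (UNIV::'m set) (\<lambda>k. {\<lfloor>y $ k / d\<rfloor>, \<lfloor>y $ k / d\<rfloor> + 1})"
      have P_PiE: "P = PiE UNIV (\<lambda>k. {\<lfloor>y $ k / d\<rfloor>, \<lfloor>y $ k / d\<rfloor> + 1})"
        by (simp add: P_def PiE_UNIV_domain)
      have fP: "finite P" and cP: "card P = 2 ^ CARD('m)"
        unfolding P_PiE by (auto intro!: finite_PiE simp: card_PiE numeral_2_eq_2)
      have "z \<in> P" if "y \<in> Q (3/5) z" for z
        unfolding P_def
      proof (rule Pi_I)
        fix k
        have "\<bar>y $ k - d * z k\<bar> \<le> 3/5 * d"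
          using that by (simp add: Q_def)
        then have "\<bar>y $ k / d - z k\<bar> \<le> 3/5"
          using d by (simp add: abs_le_iff field_simps)
        then show "z k \<in> {\<lfloor>y $ k / d\<rfloor>, \<lfloor>y $ k / d\<rfloor> + 1}"
          unfolding insert_iff by linarith
      qed
      then have "{i \<in> I. y \<in> closure (W i)} \<subseteq> c ` P"
        using clW by blast
      then have "card {i \<in> I. y \<in> closure (W i)} \<le> card (c ` P)"
        using fP by (intro card_mono) auto
      also have "\<dots> \<le> card P"
        using fP by (rule card_image_le)
      finally show ?thesis
        by (simp add: cP)
    qed
  qed
qed

section \<open>Upper semicontinuity and open colourings\<close>

text \<open>The half of Vietoris continuity that speaks of inclusion: \<open>f x\<close> staying
  inside the open set \<open>- C\<close> is an open condition on \<open>x\<close>.\<close>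

definition upper_semicontinuous_on :: "'a::topological_space set \<Rightarrow> ('a \<Rightarrow> 'b::topological_space set) \<Rightarrow> bool" where
  "upper_semicontinuous_on X f \<longleftrightarrow>
     (\<forall>C. closed C \<longrightarrow> openin (top_of_set X) {x \<in> X. f x \<inter> C = {}})"

lemma upper_semicontinuous_on_subset:
  assumes "upper_semicontinuous_on X f" "A \<subseteq> X"
  shows "upper_semicontinuous_on A f"
  unfolding upper_semicontinuous_on_def
proof (intro allI impI)
  fix C :: "'b set" assume "closed C"
  then obtain T where T: "open T" "{x \<in> X. f x \<inter> C = {}} = X \<inter> T"
    using assms(1) unfolding upper_semicontinuous_on_def openin_open by blast
  then have "{x \<in> A. f x \<inter> C = {}} = A \<inter> T"
    using assms(2) by blast
  with T(1) show "openin (top_of_set A) {x \<in> A. f x \<inter> C = {}}"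
    unfolding openin_open by blast
qed

lemma upper_semicontinuous_onD:
  assumes "upper_semicontinuous_on X f" "closed C"
  shows "\<exists>T. open T \<and> (\<forall>x\<in>X. x \<in> T \<longleftrightarrow> f x \<inter> C = {})"
proof -
  obtain T where "open T" "{x \<in> X. f x \<inter> C = {}} = X \<inter> T"
    using assms unfolding upper_semicontinuous_on_def openin_open by blast
  then show ?thesis
    by (intro exI[of _ T]) blast
qed

text \<open>Colours are open in the ambient space, and an arrow from \<open>A \<inter> G c\<close>
  must miss all of \<open>G c\<close>, since values of \<open>f\<close> may lie outside
  \<open>A\<close>.\<close>

definition open_colorable :: "'a::topological_space set \<Rightarrow> ('a \<Rightarrow> 'a set) \<Rightarrow> nat \<Rightarrow> bool" where
  "open_colorable A f N \<longleftrightarrow>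
     (\<exists>G::nat \<Rightarrow> 'a set. (\<forall>c. open (G c)) \<and> A \<subseteq> (\<Union>c<N. G c) \<and> (\<forall>c. \<forall>x\<in>A \<inter> G c. f x \<inter> G c = {}))"

lemma open_colorableI:
  assumes P: "finite P" "card P \<le> N"
    and "\<And>p. p \<in> P \<Longrightarrow> open (G p)" "A \<subseteq> (\<Union>p\<in>P. G p)"
    and "\<And>p x. p \<in> P \<Longrightarrow> x \<in> A \<Longrightarrow> x \<in> G p \<Longrightarrow> f x \<inter> G p = {}"
  shows "open_colorable A f N"
proof -
  obtain h where h: "bij_betw h {0..<card P} P"
    using ex_bij_betw_nat_finite[OF P(1)] by blast
  \<comment> \<open>The empty set is a harmless colour and fills the indices from
    \<open>card P\<close> on.\<close>
  define G' where "G' c = (if c < card P then G (h c) else {})" for c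
  have hP: "h c \<in> P" if "c < card P" for c
    using h that by (auto simp: bij_betw_def)
  have "A \<subseteq> (\<Union>c<N. G' c)"
  proof
    fix x assume "x \<in> A"
    then obtain p where p: "p \<in> P" "x \<in> G p"
      using assms(4) by blast
    then have "p \<in> h ` {0..<card P}"
      using h by (simp add: bij_betw_def)
    then obtain c where "c < card P" "p = h c"
      by auto
    then show "x \<in> (\<Union>c<N. G' c)"
      using p P(2) by (auto simp: G'_def)
  qed
  then show ?thesis
    unfolding open_colorable_def using hP assms by (intro exI[of _ G']) (auto simp: G'_def)
qed

lemma open_colorable_mono:
  assumes "open_colorable A f N" "N \<le> M"
  shows "open_colorable A f M"
proof -
  obtain G :: "nat \<Rightarrow> _" where "\<forall>c. open (G c)" "A \<subseteq> (\<Union>c<N. G c)" "\<forall>c. \<forall>x\<in>A \<inter> G c. f x \<inter> G c = {}"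
    using assms(1) unfolding open_colorable_def by (elim exE conjE)
  moreover have "(\<Union>c<N. G c) \<subseteq> (\<Union>c<M. G c)"
    using assms(2) by (intro UN_mono) auto
  ultimately show ?thesis
    unfolding open_colorable_def by (intro exI[of _ G]) simp
qed

text \<open>A closed ball about \<open>x\<close> misses the finite set \<open>f x\<close>; upper
  semicontinuity keeps \<open>f y\<close> off that ball for \<open>y\<close> near \<open>x\<close>,
  and finitely many such neighbourhoods suffice. The \<open>N\<close> found here depends on
  \<open>A\<close> and \<open>f\<close>.\<close>

lemma compact_imp_open_colorable:
  fixes A :: "'a::metric_space set"
  assumes A: "compact A" and usc: "upper_semicontinuous_on A f"
    and fin: "\<And>x. x \<in> A \<Longrightarrow> finite (f x)" and fpf: "\<And>x. x \<in> A \<Longrightarrow> x \<notin> f x"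
  obtains N where "open_colorable A f N"
proof -
  have "\<exists>U. open U \<and> x \<in> U \<and> (\<forall>y\<in>A \<inter> U. f y \<inter> U = {})" if x: "x \<in> A" for x
  proof -
    have "open (- f x)" "x \<in> - f x"
      using fin[OF x] fpf[OF x] by (auto intro: finite_imp_closed)
    then obtain e where e: "e > 0" "cball x e \<subseteq> - f x"
      by (meson open_contains_cball)
    obtain T where T: "open T" "\<And>y. y \<in> A \<Longrightarrow> y \<in> T \<longleftrightarrow> f y \<inter> cball x e = {}"
      using upper_semicontinuous_onD[OF usc closed_cball[of x e]] by blast
    show ?thesis
    proof (intro exI[of _ "T \<inter> ball x e"] conjI ballI)
      show "x \<in> T \<inter> ball x e"
        using e x T(2) by auto
      show "f y \<inter> (T \<inter> ball x e) = {}" if "y \<in> A \<inter> (T \<inter> ball x e)" for y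
        using that T(2)[of y] ball_subset_cball[of x e] by blast
    qed (use T(1) in auto)
  qed
  then obtain U where U: "\<And>x. x \<in> A \<Longrightarrow> open (U x) \<and> x \<in> U x \<and> (\<forall>y\<in>A \<inter> U x. f y \<inter> U x = {})"
    by metis
  obtain P where "P \<subseteq> A" "finite P" "A \<subseteq> (\<Union>p\<in>P. U p)"
    using compactE_image[OF A, of A U] U by blast
  moreover have "open (U p)" "x \<in> A \<Longrightarrow> x \<in> U p \<Longrightarrow> f x \<inter> U p = {}" if "p \<in> P" for p x
    using U[of p] that \<open>P \<subseteq> A\<close> by blast+
  ultimately have "open_colorable A f (card P)"
    by (intro open_colorableI[of P _ U]) simp_all
  then show thesis
    by (rule that)
qed

section \<open>Colour reduction on compact sets\<close>

text \<open>A union bound over \<open>B\<close>, applied both to the colours that \<open>f x\<close>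
  meets and to the greedy indices that it blocks.\<close>

lemma card_meeting_le:
  assumes "finite B" "card B \<le> n" "\<And>y. card {c \<in> I. y \<in> S c} \<le> r" "finite I"
  shows "card {c \<in> I. B \<inter> S c \<noteq> {}} \<le> n * r"
proof -
  have "{c \<in> I. B \<inter> S c \<noteq> {}} = (\<Union>y\<in>B. {c \<in> I. y \<in> S c})"
    by blast
  then have "card {c \<in> I. B \<inter> S c \<noteq> {}} \<le> (\<Sum>y\<in>B. card {c \<in> I. y \<in> S c})"
    using card_UN_le[OF assms(1), of "\<lambda>y. {c \<in> I. y \<in> S c}"] by simp
  also have "\<dots> \<le> card B * r"
    using sum_bounded_above[of B _ r] assms(3) by simp
  also have "\<dots> \<le> n * r"
    using assms(2) by simp
  finally show ?thesis .
qed

text \<open>The cover-free family behind the colour reduction: a word that names, for each of \<open>r\<close> other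
  colours, a position where its binary expansion differs from that of \<open>c\<close> belongs to none of them.\<close>

definition bit_words :: "nat \<Rightarrow> nat \<Rightarrow> nat \<Rightarrow> (nat \<times> bool) list set" where
  "bit_words r L c =
     {xs. set xs \<subseteq> {..<L} \<times> UNIV \<and> length xs = r \<and> (\<forall>(i, v)\<in>set xs. v = bit c i)}"

lemma bit_words_cover_free:
  assumes "L > 0" "c < 2 ^ L" "C \<subseteq> {..<2 ^ L}" "card C \<le> r" "c \<notin> C"
  obtains xs where "xs \<in> bit_words r L c" "\<And>d. d \<in> C \<Longrightarrow> xs \<notin> bit_words r L d"
proof -
  have "finite C"
    using assms(3) finite_subset by blast
  then obtain ys where ys: "set ys = C" "length ys = card C"
    using finite_distinct_list distinct_card by metis
  \<comment> \<open>Numbers below \<open>2 ^ L\<close> are determined by their first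
    \<open>L\<close> bits.\<close>
  have "\<exists>i<L. bit c i \<noteq> bit d i" if "d \<in> C" for d
  proof (rule ccontr)
    assume "\<not> ?thesis"
    then have "take_bit L c = take_bit L d"
      by (auto simp: bit_eq_iff bit_take_bit_iff)
    moreover have "take_bit L c = c" "take_bit L d = d"
      using assms that by (auto simp: take_bit_nat_eq_self_iff)
    ultimately show False
      using that assms(5) by simp
  qed
  then obtain p where p: "\<And>d. d \<in> C \<Longrightarrow> p d < L \<and> bit c (p d) \<noteq> bit d (p d)"
    by metis
  \<comment> \<open>Padding with the entry \<open>(0, bit c 0)\<close>, legal because
    \<open>L > 0\<close>, brings the word to length exactly \<open>r\<close> without leaving the
    family of \<open>c\<close>.\<close>
  define xs where "xs = map (\<lambda>d. (p d, bit c (p d))) ys @ replicate (r - card C) (0, bit c 0)"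
  show thesis
  proof
    show "xs \<in> bit_words r L c"
      using p ys assms by (auto simp: bit_words_def xs_def)
    fix d assume "d \<in> C"
    then have "(p d, bit c (p d)) \<in> set xs"
      using ys by (auto simp: xs_def)
    then show "xs \<notin> bit_words r L d"
      using p[OF \<open>d \<in> C\<close>] by (auto simp: bit_words_def)
  qed
qed

text \<open>One round of Linial's reduction. A point \<open>x\<close> of old colour \<open>c\<close>
  takes as new colour a word in the family of \<open>c\<close> that lies in no family of a colour
  met by \<open>f x\<close>. There are \<open>(2 * L) ^ r\<close> words: \<open>r\<close> entries,
  each a position and a bit.\<close>

lemma open_colorable_reduce:
  fixes A :: "(real ^ 'm) set"
  assumes A: "compact A" and usc: "upper_semicontinuous_on A f"
    and f: "\<And>x. x \<in> A \<Longrightarrow> finite (f x) \<and> card (f x) \<le> n"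
    and r: "r = n * 2 ^ CARD('m)" and L: "L > 0" and col: "open_colorable A f (2 ^ L)"
  shows "open_colorable A f ((2 * L) ^ r)"
proof -
  obtain G :: "nat \<Rightarrow> (real ^ 'm) set" where G: "\<And>c. open (G c)" "A \<subseteq> (\<Union>c<2 ^ L. G c)"
    "\<And>c x. x \<in> A \<Longrightarrow> x \<in> G c \<Longrightarrow> f x \<inter> G c = {}"
    using col unfolding open_colorable_def by blast
  obtain W D where W: "\<And>c. open (W c)" "\<And>c. closed (D c)" "\<And>c. D c \<subseteq> W c"
    "\<And>c. c \<in> {..<2 ^ L} \<Longrightarrow> closure (W c) \<subseteq> G c" "A \<subseteq> (\<Union>c<2 ^ L. D c)"
    "\<And>y. card {c \<in> {..<2 ^ L}. y \<in> closure (W c)} \<le> 2 ^ CARD('m)"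
    by (rule bounded_order_shrinking[where G = G, OF A finite_lessThan G(1) G(2)]) (rule that; assumption)
  define P where "P = {xs :: (nat \<times> bool) list. set xs \<subseteq> {..<L} \<times> UNIV \<and> length xs = r}"
  have P: "finite P" "card P = (2 * L) ^ r"
    unfolding P_def using card_lists_length_eq[of "{..<L} \<times> (UNIV::bool set)" r]
    by (auto intro: finite_lists_length_eq simp: card_cartesian_product mult.commute)
  define I where "I xs = {c. c < 2 ^ L \<and> xs \<in> bit_words r L c}" for xs
  have finI: "finite (I xs)" for xs
    by (simp add: I_def)
  \<comment> \<open>Upper semicontinuity applies to closed obstacles, hence the closures of the
    \<open>W c\<close>, whose overlap the shrinking also bounds.\<close>
  have "closed (\<Union>c\<in>I xs. closure (W c))" for xs
    using finI by (intro closed_UN) auto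
  then have "\<exists>T. open T \<and> (\<forall>x\<in>A. x \<in> T \<longleftrightarrow> f x \<inter> (\<Union>c\<in>I xs. closure (W c)) = {})" for xs
    using upper_semicontinuous_onD[OF usc] by simp
  then obtain T where T: "\<And>xs. open (T xs)"
    "\<And>xs x. x \<in> A \<Longrightarrow> x \<in> T xs \<longleftrightarrow> f x \<inter> (\<Union>c\<in>I xs. closure (W c)) = {}"
    by metis
  show ?thesis
  \<comment> \<open>The class of \<open>xs\<close>: within \<open>A\<close>, points in an old colour
    owning \<open>xs\<close> whose values avoid every old colour owning \<open>xs\<close>.\<close>
  proof (rule open_colorableI[OF P(1), of _ "\<lambda>xs. T xs \<inter> (\<Union>c\<in>I xs. W c)"])
    show "card P \<le> (2 * L) ^ r"
      using P by simp
    show "open (T xs \<inter> (\<Union>c\<in>I xs. W c))" for xs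
      using T(1) W(1) by auto
    show "f x \<inter> (T xs \<inter> (\<Union>c\<in>I xs. W c)) = {}"
      if "x \<in> A" "x \<in> T xs \<inter> (\<Union>c\<in>I xs. W c)" for xs x
      using T(2)[OF that(1), of xs] that(2) closure_subset by blast
    show "A \<subseteq> (\<Union>xs\<in>P. T xs \<inter> (\<Union>c\<in>I xs. W c))"
    proof
      fix x assume x: "x \<in> A"
      then obtain c where c: "c < 2 ^ L" "x \<in> W c"
        using W(3,5) by blast
      define C where "C = {c \<in> {..<2 ^ L}. f x \<inter> closure (W c) \<noteq> {}}"
      have "card C \<le> r"
        unfolding C_def r using f[OF x] W(6) by (intro card_meeting_le) auto
      moreover have "c \<notin> C"
        using G(3)[OF x, of c] W(4)[of c] c closure_subset unfolding C_def by blast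
      ultimately obtain xs where xs: "xs \<in> bit_words r L c" "\<And>d. d \<in> C \<Longrightarrow> xs \<notin> bit_words r L d"
        using bit_words_cover_free[OF L c(1), of C r] by (auto simp: C_def)
      have "x \<in> T xs"
        using T(2)[OF x] xs(2) by (auto simp: I_def C_def)
      moreover have "xs \<in> P"
        using xs(1) by (auto simp: P_def bit_words_def)
      ultimately show "x \<in> (\<Union>xs\<in>P. T xs \<inter> (\<Union>c\<in>I xs. W c))"
        using c xs(1) by (auto simp: I_def)
    qed
  qed
qed

text \<open>\<open>(2 * L) ^ r\<close> grows polynomially in \<open>L\<close> and
  \<open>2 ^ (L - 1)\<close> exponentially, so the reduction keeps lowering the number of colours
  down to a threshold that depends on \<open>n\<close> and \<open>CARD('m)\<close> alone.\<close>

lemma compact_open_colorable_bound: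
  obtains K where "\<And>(A :: (real ^ 'm) set) f.
    \<lbrakk>compact A; upper_semicontinuous_on A f; \<And>x. x \<in> A \<Longrightarrow> finite (f x) \<and> card (f x) \<le> n;
     \<And>x. x \<in> A \<Longrightarrow> x \<notin> f x\<rbrakk> \<Longrightarrow> open_colorable A f K"
proof -
  define r where "r = n * 2 ^ CARD('m)"
  have "eventually (\<lambda>L::nat. (2 * real L) ^ r \<le> 2 ^ (L - 1)) at_top"
    by real_asymp
  then obtain L0 where L0: "\<And>L. L \<ge> L0 \<Longrightarrow> (2 * real L) ^ r \<le> 2 ^ (L - 1)"
    by (auto simp: eventually_at_top_linorder)
  have L0: "(2 * L) ^ r \<le> 2 ^ (L - 1)" if "L \<ge> L0" for L
    using L0[OF that] by (metis (mono_tags) of_nat_le_iff of_nat_mult of_nat_numeral of_nat_power)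
  show thesis
  proof (rule that)
    fix A :: "(real ^ 'm) set" and f
    assume A: "compact A" and usc: "upper_semicontinuous_on A f"
      and f: "\<And>x. x \<in> A \<Longrightarrow> finite (f x) \<and> card (f x) \<le> n"
      and fpf: "\<And>x. x \<in> A \<Longrightarrow> x \<notin> f x"
    have reduce: "open_colorable A f N \<Longrightarrow> open_colorable A f (2 ^ L0)" for N
    proof (induction N rule: less_induct)
      case (less N)
      show ?case
      proof (cases "N \<le> 2 ^ L0")
        case True
        with less.prems show ?thesis
          by (rule open_colorable_mono)
      next
        case False
        \<comment> \<open>Minimality of \<open>L\<close> gives \<open>2 ^ (L - 1) < N\<close>. The
          exponent \<open>L - 1\<close> in the threshold thus makes the reduced count strictly
          smaller than \<open>N\<close>.\<close>
        define L where "L = (LEAST L. N \<le> 2 ^ L)"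
        have NL: "N \<le> 2 ^ L"
          unfolding L_def by (rule LeastI[of _ N]) (simp add: less_imp_le)
        have "L0 < L"
        proof (rule ccontr)
          assume "\<not> L0 < L"
          then have "(2::nat) ^ L \<le> 2 ^ L0"
            by (intro power_increasing) auto
          with NL False show False
            by linarith
        qed
        then have "L > 0" "L - 1 < L"
          by auto
        then have "2 ^ (L - 1) < N"
          using not_less_Least[of "L - 1" "\<lambda>L. N \<le> 2 ^ L"] by (simp add: L_def)
        then have "(2 * L) ^ r < N"
          using L0[of L] \<open>L0 < L\<close> by simp
        moreover have "open_colorable A f ((2 * L) ^ r)"
          by (rule open_colorable_reduce[OF A usc f r_def \<open>L > 0\<close> open_colorable_mono[OF less.prems NL]])
        ultimately show ?thesis
          by (rule less.IH)
      qed
    qed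
    obtain N where "open_colorable A f N"
      using compact_imp_open_colorable[OF A usc] f fpf by blast
    then show "open_colorable A f (2 ^ L0)"
      by (rule reduce)
  qed
qed

section \<open>Gluing infinitely many compact pieces\<close>

text \<open>Each finite value lies in some ball about 0, and lying in a fixed open ball is a
  relatively open condition; compactness leaves finitely many radii. This dictates the growth of the
  shells.\<close>

lemma upper_semicontinuous_on_compact_bounded:
  fixes f :: "'a::topological_space \<Rightarrow> 'b::real_normed_vector set"
  assumes C: "compact C" and usc: "upper_semicontinuous_on C f"
    and fin: "\<And>x. x \<in> C \<Longrightarrow> finite (f x)"
  shows "\<exists>r. \<forall>x\<in>C. f x \<subseteq> ball 0 r"
proof -
  have "\<exists>T. open T \<and> (\<forall>x\<in>C. x \<in> T \<longleftrightarrow> f x \<inter> - ball 0 (real k) = {})" for k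
    by (intro upper_semicontinuous_onD[OF usc] closed_Compl open_ball)
  then obtain T where T: "\<And>k. open (T k)"
    "\<And>k x. x \<in> C \<Longrightarrow> x \<in> T k \<longleftrightarrow> f x \<inter> - ball 0 (real k) = {}"
    by metis
  have cover: "C \<subseteq> (\<Union>k. T k)"
  proof
    fix x assume x: "x \<in> C"
    then have "bounded (f x)"
      using fin finite_imp_bounded by blast
    then obtain b where b: "\<And>y. y \<in> f x \<Longrightarrow> norm y \<le> b"
      by (auto simp: bounded_iff)
    obtain k :: nat where "b < k"
      using reals_Archimedean2 by blast
    then have "x \<in> T k"
      using T(2)[OF x, of k] b by fastforce
    then show "x \<in> (\<Union>k. T k)"
      by blast
  qed
  obtain P where P: "P \<subseteq> UNIV" "finite P" "C \<subseteq> (\<Union>k\<in>P. T k)"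
    by (rule compactE_image[where f = T, OF C T(1) cover]) (rule that; assumption)
  have "f x \<subseteq> ball 0 (real (Max P))" if x: "x \<in> C" for x
  proof -
    obtain k where k: "k \<in> P" "x \<in> T k"
      using P x by blast
    then have "f x \<subseteq> ball 0 (real k)"
      using T(2)[OF x] by blast
    also have "\<dots> \<subseteq> ball 0 (real (Max P))"
      using P(2) k(1) by (intro subset_ball) simp
    finally show ?thesis .
  qed
  then show ?thesis
    by blast
qed

text \<open>The unit ball about \<open>x\<close> meets only finitely many \<open>S k\<close>, and
  their closed union can be removed from it. This keeps colours glued from infinitely many shells
  closed.\<close>

lemma closed_UN_bounded_finite:
  fixes S :: "'i \<Rightarrow> 'a::real_normed_vector set"
  assumes S: "\<And>k. closed (S k)" and fin: "\<And>r. finite {k. S k \<inter> cball 0 r \<noteq> {}}"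
  shows "closed (\<Union>k. S k)"
  unfolding closed_def
proof (subst open_subopen, intro ballI)
  fix x assume x: "x \<in> - (\<Union>k. S k)"
  define C where "C = (\<Union>k\<in>{k. S k \<inter> cball 0 (norm x + 1) \<noteq> {}}. S k)"
  have "closed C"
    unfolding C_def using S fin by (intro closed_UN) auto
  then have "open (ball x 1 - C)"
    by (intro open_Diff) auto
  moreover have "x \<in> ball x 1 - C"
    using x by (auto simp: C_def)
  moreover have "ball x 1 \<subseteq> cball 0 (norm x + 1)"
  proof
    fix y assume "y \<in> ball x 1"
    then show "y \<in> cball 0 (norm x + 1)"
      using norm_triangle_sub[of y x] by (simp add: dist_norm norm_minus_commute)
  qed
  then have "ball x 1 - C \<subseteq> - (\<Union>k. S k)"
    unfolding C_def by blast
  ultimately show "\<exists>T. open T \<and> x \<in> T \<and> T \<subseteq> - (\<Union>k. S k)"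
    by blast
qed

text \<open>Arrows to earlier pieces are handled greedily: the piece \<open>A k\<close> is covered after all
  earlier ones, and each of the at most \<open>n\<close> values blocks at most \<open>2 ^ CARD('m)\<close> indices.
  Arrows inside a piece are handled by the given colouring of that piece, and the final colours
  are pairs.\<close>

lemma graded_union_bright_cover:
  fixes A N :: "nat \<Rightarrow> (real ^ 'm) set"
  assumes A: "\<And>k. compact (A k)"
    and N: "\<And>k. open (N k)" "\<And>k. A k \<subseteq> N k" "\<And>j k. j \<noteq> k \<Longrightarrow> N j \<inter> N k = {}"
    and locfin: "\<And>r. finite {k. A k \<inter> cball 0 r \<noteq> {}}"
    and usc: "\<And>k. upper_semicontinuous_on (A k) f"
    and f: "\<And>k x. x \<in> A k \<Longrightarrow> finite (f x) \<and> card (f x) \<le> n"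
    and later: "\<And>j k x. x \<in> A k \<Longrightarrow> k < j \<Longrightarrow> f x \<inter> N j = {}"
    and col: "\<And>k. open_colorable (A k) f K"
  obtains F :: "nat \<times> nat \<Rightarrow> (real ^ 'm) set"
  where "\<And>p. closed (F p)" "\<And>p. F p \<subseteq> (\<Union>k. A k)"
    "(\<Union>k. A k) \<subseteq> (\<Union>p\<in>{..<K} \<times> {..n * 2 ^ CARD('m)}. F p)"
    "\<And>p. p \<in> {..<K} \<times> {..n * 2 ^ CARD('m)} \<Longrightarrow> F p \<inter> closure (\<Union>x\<in>F p. f x) = {}"
proof -
  define q :: nat where "q = 2 ^ CARD('m)"
  \<comment> \<open>\<open>J\<close> has \<open>n * q + 1\<close> elements, one more than the values
    at a point can block.\<close>
  define J where "J = {..n * q}"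
  have finJ: "finite J"
    by (simp add: J_def)
  \<comment> \<open>Invariant of a recursion over \<open>k\<close>: \<open>r\<close> holds open sets
    and closed shrinkings for piece \<open>k\<close>, and the last clause forbids arrows into the
    same index of an earlier piece. It consults \<open>g\<close> only below \<open>k\<close>, as
    well-founded choice requires.\<close>
  define P where "P g k r \<longleftrightarrow> (\<forall>b. open (fst r b)) \<and> (\<forall>b. closed (snd r b)) \<and> (\<forall>b. snd r b \<subseteq> fst r b) \<and>
      (\<forall>b\<in>J. closure (fst r b) \<subseteq> N k) \<and> A k \<subseteq> (\<Union>b\<in>J. snd r b) \<and>
      (\<forall>y. card {b \<in> J. y \<in> closure (fst r b)} \<le> q) \<and>
      (\<forall>b\<in>J. \<forall>x\<in>A k \<inter> snd r b. \<forall>j<k. f x \<inter> closure (fst (g j) b) = {})"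
    for g :: "nat \<Rightarrow> (nat \<Rightarrow> (real ^ 'm) set) \<times> (nat \<Rightarrow> (real ^ 'm) set)" and k r
  have "\<exists>g. \<forall>k. P g k (g k)"
  proof (rule dependent_wf_choice[OF wf_less_than])
    show "P g k r = P h k r" if "\<And>z. (z, k) \<in> less_than \<Longrightarrow> g z = h z" for g h k r
      using that by (simp add: P_def)
    fix k g
    assume "\<And>j. (j, k) \<in> less_than \<Longrightarrow> P g j (g j)"
    then have g: "P g j (g j)" if "j < k" for j
      using that by simp
    define S where "S b = (\<Union>j<k. closure (fst (g j) b))" for b
    have "closed (S b)" for b
      unfolding S_def by (intro closed_UN) auto
    then have "\<exists>T. open T \<and> (\<forall>x\<in>A k. x \<in> T \<longleftrightarrow> f x \<inter> S b = {})" for b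
      by (rule upper_semicontinuous_onD[OF usc])
    then obtain T where T: "\<And>b. open (T b)" "\<And>b x. x \<in> A k \<Longrightarrow> x \<in> T b \<longleftrightarrow> f x \<inter> S b = {}"
      by metis
    \<comment> \<open>The bound \<open>q\<close> does not accumulate over earlier pieces: their sets
      lie in the disjoint \<open>N i\<close>, so a single piece accounts for all occurrences of
      \<open>y\<close>.\<close>
    have S_order: "card {b \<in> J. y \<in> S b} \<le> q" for y
    proof (cases "\<exists>b\<in>J. y \<in> S b")
      case True
      then obtain b j where bj: "b \<in> J" "j < k" "y \<in> closure (fst (g j) b)"
        by (auto simp: S_def)
      have inN: "y \<in> N i" if "c \<in> J" "i < k" "y \<in> closure (fst (g i) c)" for c i
        using g[OF that(2)] that unfolding P_def by blast
      have "{b \<in> J. y \<in> S b} \<subseteq> {b \<in> J. y \<in> closure (fst (g j) b)}"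
      proof
        fix b' assume "b' \<in> {b \<in> J. y \<in> S b}"
        then obtain i where i: "b' \<in> J" "i < k" "y \<in> closure (fst (g i) b')"
          by (auto simp: S_def)
        then have "i = j"
          using inN[OF i] inN[OF bj] N(3)[of i j] by blast
        with i show "b' \<in> {b \<in> J. y \<in> closure (fst (g j) b)}"
          by blast
      qed
      then have "card {b \<in> J. y \<in> S b} \<le> card {b \<in> J. y \<in> closure (fst (g j) b)}"
        using finJ by (intro card_mono) auto
      also have "\<dots> \<le> q"
        using g[OF bj(2)] by (simp add: P_def)
      finally show ?thesis .
    next
      case False
      then have "{b \<in> J. y \<in> S b} = {}"
        by blast
      then show ?thesis
        by (metis card.empty le0)
    qed
    \<comment> \<open>At most \<open>n * q\<close> indices are blocked, so some \<open>b\<close> in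
      \<open>J\<close> is free; intersecting with \<open>N k\<close> preserves disjointness for
      later stages.\<close>
    have cover: "A k \<subseteq> (\<Union>b\<in>J. T b \<inter> N k)"
    proof
      fix x assume x: "x \<in> A k"
      have "card {b \<in> J. f x \<inter> S b \<noteq> {}} \<le> n * q"
        using f[OF x] S_order finJ by (intro card_meeting_le) auto
      also have "n * q < card J"
        by (simp add: J_def)
      finally have "{b \<in> J. f x \<inter> S b \<noteq> {}} \<noteq> J"
        by auto
      then show "x \<in> (\<Union>b\<in>J. T b \<inter> N k)"
        using T(2)[OF x] N(2) x by blast
    qed
    have TN_open: "open (T b \<inter> N k)" for b
      using T(1) N(1) by blast
    obtain W D where WD: "\<And>b. open (W b)" "\<And>b. closed (D b)" "\<And>b. D b \<subseteq> W b"
      "\<And>b. b \<in> J \<Longrightarrow> closure (W b) \<subseteq> T b \<inter> N k" "A k \<subseteq> (\<Union>b\<in>J. D b)"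
      "\<And>y. card {b \<in> J. y \<in> closure (W b)} \<le> 2 ^ CARD('m)"
      by (rule bounded_order_shrinking[where G = "\<lambda>b. T b \<inter> N k", OF A finJ TN_open cover]) (rule that; assumption)
    have "f x \<inter> closure (fst (g j) b) = {}" if "b \<in> J" "x \<in> A k \<inter> D b" "j < k" for b x j
    proof -
      have "x \<in> T b"
        using WD(3)[of b] WD(4)[OF that(1)] closure_subset[of "W b"] that(2) by blast
      then show ?thesis
        using T(2)[of x b] that unfolding S_def by blast
    qed
    then have "P g k (W, D)"
      using WD by (auto simp: P_def q_def)
    then show "\<exists>r. P g k r" ..
  qed
  then obtain g where g: "\<And>k. P g k (g k)"
    by blast
  define W where "W k = fst (g k)" for k
  define D where "D k = snd (g k)" for k
  have W: "open (W k b)" "closed (D k b)" "D k b \<subseteq> W k b" "A k \<subseteq> (\<Union>b\<in>J. D k b)" for k b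
    using g[of k] by (simp_all add: P_def W_def D_def)
  have WN: "W k b \<subseteq> N k" if "b \<in> J" for k b
    using g[of k] that closure_subset[of "W k b"] unfolding P_def W_def by blast
  have W_back: "f x \<inter> W j b = {}" if "b \<in> J" "x \<in> A k" "x \<in> D k b" "j < k" for k j b x
    using g[of k] that closure_subset[of "W j b"] unfolding P_def W_def D_def by blast
  \<comment> \<open>The inner colouring is shrunk as well: the final colours must be closed sets
    inside open ones.\<close>
  have "\<exists>G E. (\<forall>a. open (G a)) \<and> (\<forall>a. closed (E a)) \<and> (\<forall>a<K. E a \<subseteq> G a) \<and>
      A k \<subseteq> (\<Union>a<K. E a) \<and> (\<forall>a. \<forall>x\<in>A k \<inter> G a. f x \<inter> G a = {})" for k
  proof -
    obtain G :: "nat \<Rightarrow> _" where G: "\<And>a. open (G a)" "A k \<subseteq> (\<Union>a<K. G a)"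
      "\<forall>a. \<forall>x\<in>A k \<inter> G a. f x \<inter> G a = {}"
      using col[of k] unfolding open_colorable_def by blast
    obtain V E where VE: "\<And>a. closed (E a)" "\<And>a. E a \<subseteq> V a"
      "\<And>a. a \<in> {..<K} \<Longrightarrow> closure (V a) \<subseteq> G a" "A k \<subseteq> (\<Union>a<K. E a)"
      by (rule bounded_order_shrinking[where G = G, OF A finite_lessThan G(1) G(2)]) (rule that; assumption)
    have "E a \<subseteq> G a" if "a < K" for a
      using VE(2)[of a] VE(3)[of a] closure_subset[of "V a"] that by blast
    then show ?thesis
      using G VE(1,4) by (intro exI[of _ G] exI[of _ E]) simp
  qed
  then obtain G E where G: "\<And>k a. open (G k a)" "\<And>k a. closed (E k a)" "\<And>k a. a < K \<Longrightarrow> E k a \<subseteq> G k a"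
    "\<And>k. A k \<subseteq> (\<Union>a<K. E k a)" "\<And>k a x. x \<in> A k \<Longrightarrow> x \<in> G k a \<Longrightarrow> f x \<inter> G k a = {}"
    by (metis IntI)
  define F where "F p = (\<Union>k. A k \<inter> E k (fst p) \<inter> D k (snd p))" for p
  show thesis
  proof
    show "closed (F p)" for p
      unfolding F_def
    proof (rule closed_UN_bounded_finite)
      show "closed (A k \<inter> E k (fst p) \<inter> D k (snd p))" for k
        by (intro closed_Int compact_imp_closed[OF A] G(2) W(2))
      show "finite {k. A k \<inter> E k (fst p) \<inter> D k (snd p) \<inter> cball 0 r \<noteq> {}}" for r
        by (rule finite_subset[OF _ locfin[of r]]) blast
    qed
    show "F p \<subseteq> (\<Union>k. A k)" for p
      by (auto simp: F_def)
    show "(\<Union>k. A k) \<subseteq> (\<Union>p\<in>{..<K} \<times> {..n * 2 ^ CARD('m)}. F p)"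
    proof
      fix x assume "x \<in> (\<Union>k. A k)"
      then obtain k where k: "x \<in> A k"
        by blast
      then obtain a b where "a < K" "x \<in> E k a" "b \<in> J" "x \<in> D k b"
        using G(4)[of k] W(4)[of k] by blast
      then show "x \<in> (\<Union>p\<in>{..<K} \<times> {..n * 2 ^ CARD('m)}. F p)"
        using k by (intro UN_I[of "(a, b)"]) (auto simp: F_def J_def q_def)
    qed
    fix p assume "p \<in> {..<K} \<times> {..n * 2 ^ CARD('m)}"
    then obtain a b where p: "p = (a, b)" "a < K" "b \<in> J"
      by (auto simp: J_def q_def)
    \<comment> \<open>An open neighbourhood of \<open>F p\<close> that no value of \<open>f\<close>
      on \<open>F p\<close> enters; being open, it also misses the closure of all these
      values.\<close>
    define U where "U = (\<Union>k. G k a \<inter> W k b)"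
    have "open U"
      unfolding U_def using G(1) W(1) by blast
    have FU: "F p \<subseteq> U"
    proof
      fix x assume "x \<in> F p"
      then obtain k where "x \<in> E k a" "x \<in> D k b"
        by (auto simp: F_def p(1))
      then have "x \<in> G k a \<inter> W k b"
        using G(3)[OF p(2), of k] W(3)[of k b] by blast
      then show "x \<in> U"
        unfolding U_def by blast
    qed
    have avoid: "f x \<inter> (G j a \<inter> W j b) = {}" if "x \<in> A k" "x \<in> E k a" "x \<in> D k b" for x j k
    proof -
      \<comment> \<open>Earlier pieces are avoided through the greedy index, the own piece through
        the inner colour, later pieces by hypothesis.\<close>
      consider "j < k" | "j = k" | "k < j"
        by linarith
      then show ?thesis
      proof cases
        case 1
        then show ?thesis
          using W_back[OF p(3) that(1,3)] by blast
      next
        case 2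
        then show ?thesis
          using G(5)[OF that(1), of a] G(3)[OF p(2), of k] that(2) by blast
      next
        case 3
        then show ?thesis
          using later[OF that(1)] WN[OF p(3), of j] by blast
      qed
    qed
    have "(\<Union>x\<in>F p. f x) \<subseteq> - U"
    proof (rule UN_least)
      fix x assume "x \<in> F p"
      then obtain k where "x \<in> A k" "x \<in> E k a" "x \<in> D k b"
        by (auto simp: F_def p(1))
      then show "f x \<subseteq> - U"
        using avoid[of x k] unfolding U_def by blast
    qed
    then have "closure (\<Union>x\<in>F p. f x) \<subseteq> - U"
      using \<open>open U\<close> by (intro closure_minimal) auto
    then show "F p \<inter> closure (\<Union>x\<in>F p. f x) = {}"
      using FU by blast
  qed
qed

section \<open>From Vietoris continuity to shells and the final bound\<close>

text \<open>Take the preimage of the basic set of \<open>{- C}\<close>: as \<open>f x\<close> is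
  nonempty, inclusion in \<open>- C\<close> already makes it meet \<open>- C\<close>.\<close>

lemma continuous_map_exp_space_imp_upper_semicontinuous:
  assumes "continuous_map (top_of_set X) (exp_space n euclidean) f"
  shows "upper_semicontinuous_on X f"
  unfolding upper_semicontinuous_on_def
proof (intro allI impI)
  fix C :: "'b set" assume C: "closed C"
  let ?E = "{B. finite B \<and> card B \<le> n}"
  have E: "f x \<in> ?E \<and> closed (f x) \<and> f x \<noteq> {}" if "x \<in> X" for x
    using assms that by (auto simp: continuous_map_def exp_space_def topspace_vietoris Pi_iff)
  have "openin (vietoris euclidean) (vietoris_basic euclidean {- C})"
    unfolding vietoris_def by (rule topology_generated_by_Basis) (use C in auto)
  then have "openin (exp_space n euclidean) (vietoris_basic euclidean {- C} \<inter> ?E)"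
    unfolding exp_space_def openin_subtopology by blast
  from openin_continuous_map_preimage[OF assms this]
  have "openin (top_of_set X) {x \<in> X. f x \<in> vietoris_basic euclidean {- C} \<inter> ?E}"
    by simp
  also have "{x \<in> X. f x \<in> vietoris_basic euclidean {- C} \<inter> ?E} = {x \<in> X. f x \<inter> C = {}}"
    using E by (auto simp: vietoris_basic_def)
  finally show "openin (top_of_set X) {x \<in> X. f x \<inter> C = {}}" .
qed

theorem theorem2p7:
  fixes n :: nat
  assumes "n \<ge> 1"
  shows "\<exists>K::nat. \<forall>(X :: (real ^ 'm) set) f.
           closed X \<longrightarrow>
           continuous_map (subtopology euclidean X) (exp_space n euclidean) f \<longrightarrow>
           fixed_point_free_on X f \<longrightarrow>
           bright_colorable euclidean X f K"
proof -
  obtain K where K: "\<And>(A :: (real ^ 'm) set) f.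
    \<lbrakk>compact A; upper_semicontinuous_on A f; \<And>x. x \<in> A \<Longrightarrow> finite (f x) \<and> card (f x) \<le> n;
     \<And>x. x \<in> A \<Longrightarrow> x \<notin> f x\<rbrakk> \<Longrightarrow> open_colorable A f K"
    using compact_open_colorable_bound[where n = n and 'm = 'm] by blast
  define I where "I = {..<K} \<times> {..n * 2 ^ CARD('m)}"
  have "finite I"
    by (simp add: I_def)
  \<comment> \<open>The factor 2 counts the two parities of shells.\<close>
  have "bright_colorable euclidean X f (2 * card I)"
    if X: "closed X" and cont: "continuous_map (top_of_set X) (exp_space n euclidean) f"
      and fpf: "fixed_point_free_on X f" for X :: "(real ^ 'm) set" and f
  proof -
    have usc: "upper_semicontinuous_on B f" if "B \<subseteq> X" for B
      using continuous_map_exp_space_imp_upper_semicontinuous[OF cont] that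
      by (rule upper_semicontinuous_on_subset)
    have f: "finite (f x) \<and> card (f x) \<le> n" "x \<notin> f x" if "x \<in> X" for x
      using cont fpf that
      by (auto simp: continuous_map_def exp_space_def Pi_iff fixed_point_free_on_def)
    have "\<exists>s. \<forall>x\<in>X \<inter> cball 0 r. f x \<subseteq> ball 0 s" for r
      by (rule upper_semicontinuous_on_compact_bounded[OF closed_Int_compact[OF X compact_cball] usc])
        (simp_all add: f)
    then obtain s where "\<forall>r. \<forall>x\<in>X \<inter> cball 0 r. f x \<subseteq> ball 0 (s r)"
      by metis
    then have s: "f x \<subseteq> ball 0 (s r)" if "x \<in> X" "norm x \<le> r" for r x
      using that by simp
    \<comment> \<open>The gap 2 leaves room for the unit margins of \<open>N\<close>; the term
      \<open>s r + 1\<close> keeps the values of points of norm at most \<open>R k\<close> within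
      radius \<open>R (Suc k) - 1\<close>.\<close>
    define R where "R = rec_nat 0 (\<lambda>_ r. max (r + 2) (s r + 1))"
    have R0: "R 0 = 0" and R_Suc: "R (Suc k) \<ge> R k + 2" "R (Suc k) \<ge> s (R k) + 1" for k
      by (simp_all add: R_def)
    have R_mono: "R j \<le> R k" if "j \<le> k" for j k
    proof (rule lift_Suc_mono_le[OF _ that])
      show "R i \<le> R (Suc i)" for i
        using R_Suc(1)[of i] by linarith
    qed
    have R_ge: "R k \<ge> k" for k
    proof (induction k)
      case (Suc k)
      then show ?case
        using R_Suc(1)[of k] by simp
    qed (simp add: R0)
    define A where "A k = X \<inter> {x. R k \<le> norm x \<and> norm x \<le> R (Suc k)}" for k
    \<comment> \<open>Margins of adjacent shells overlap, but those with indices at least two apart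
      are disjoint.\<close>
    define N :: "nat \<Rightarrow> (real ^ 'm) set" where "N k = {x. R k - 1 < norm x \<and> norm x < R (Suc k) + 1}" for k
    have A_compact: "compact (A k)" for k
    proof -
      have "A k = (X \<inter> {x. R k \<le> norm x}) \<inter> cball 0 (R (Suc k))"
        by (auto simp: A_def)
      moreover have "closed (X \<inter> {x. R k \<le> norm x})"
        using X by (intro closed_Int closed_Collect_le continuous_intros)
      ultimately show ?thesis
        by (simp add: closed_Int_compact)
    qed
    have N_open: "open (N k)" for k
      unfolding N_def by (intro open_Collect_conj open_Collect_less continuous_intros)
    have A_cover: "X \<subseteq> (\<Union>k. A k)"
    proof
      fix x assume x: "x \<in> X"
      \<comment> \<open>Minimality also yields the lower bound \<open>R k \<le> norm x\<close>, with
        \<open>R 0 = 0\<close> covering the centre.\<close>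
      define k where "k = (LEAST k. norm x \<le> R (Suc k))"
      obtain i :: nat where "norm x < i"
        using reals_Archimedean2 by blast
      then have "norm x \<le> R (Suc i)"
        using R_ge[of "Suc i"] by simp
      then have "norm x \<le> R (Suc k)"
        unfolding k_def by (rule LeastI)
      moreover have "R k \<le> norm x"
      proof (cases k)
        case (Suc l)
        then show ?thesis
          using not_less_Least[of l "\<lambda>k. norm x \<le> R (Suc k)"] by (simp add: k_def)
      qed (simp add: R0)
      ultimately show "x \<in> (\<Union>k. A k)"
        using x by (auto simp: A_def)
    qed
    have gap: "R (Suc j) + 2 \<le> R k" if "Suc j < k" for j k
      using R_Suc(1)[of "Suc j"] R_mono[of "Suc (Suc j)" k] that by simp
    have N_disjoint: "N j \<inter> N k = {}" if "Suc j < k" for j k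
      using gap[OF that] by (auto simp: N_def)
    \<comment> \<open>Values may reach the next shell outwards but none beyond, so within one parity
      class no arrow leads outwards.\<close>
    have later: "f x \<inter> N j = {}" if "x \<in> A k" "Suc k < j" for j k x
    proof -
      have "f x \<subseteq> ball 0 (s (R (Suc k)))"
        using that by (intro s) (auto simp: A_def)
      moreover have "s (R (Suc k)) \<le> R j - 1"
        using R_Suc(2)[of "Suc k"] R_mono[of "Suc (Suc k)" j] that by simp
      ultimately show ?thesis
        by (force simp: N_def)
    qed
    \<comment> \<open>The instances \<open>i = 0\<close> and \<open>i = 1\<close> are the two parity
      classes.\<close>
    have "\<exists>F. (\<forall>p\<in>I. bright_color euclidean X f (F p)) \<and> (\<Union>k. A (2 * k + i)) \<subseteq> (\<Union>p\<in>I. F p)" for i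
    proof -
      obtain F :: "nat \<times> nat \<Rightarrow> (real ^ 'm) set"
        where F: "\<And>p. closed (F p)" "\<And>p. F p \<subseteq> (\<Union>k. A (2 * k + i))"
          "(\<Union>k. A (2 * k + i)) \<subseteq> (\<Union>p\<in>{..<K} \<times> {..n * 2 ^ CARD('m)}. F p)"
          "\<And>p. p \<in> {..<K} \<times> {..n * 2 ^ CARD('m)} \<Longrightarrow> F p \<inter> closure (\<Union>x\<in>F p. f x) = {}"
      proof (rule graded_union_bright_cover[of "\<lambda>k. A (2 * k + i)" "\<lambda>k. N (2 * k + i)" f n K])
        show "A (2 * k + i) \<subseteq> N (2 * k + i)" for k
          by (auto simp: A_def N_def)
        show "N (2 * j + i) \<inter> N (2 * k + i) = {}" if "j \<noteq> k" for j k
          using that N_disjoint[of "2 * j + i" "2 * k + i"] N_disjoint[of "2 * k + i" "2 * j + i"]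
          by (cases j k rule: linorder_cases) auto
        \<comment> \<open>Since \<open>R k \<ge> k\<close>, all but finitely many shells lie outside
          any given ball.\<close>
        show "finite {k. A (2 * k + i) \<inter> cball 0 r \<noteq> {}}" for r
        proof (rule finite_subset)
          show "{k. A (2 * k + i) \<inter> cball 0 r \<noteq> {}} \<subseteq> {..nat \<lceil>r\<rceil>}"
          proof
            fix k assume "k \<in> {k. A (2 * k + i) \<inter> cball 0 r \<noteq> {}}"
            then have "R (2 * k + i) \<le> r"
              by (auto simp: A_def)
            then show "k \<in> {..nat \<lceil>r\<rceil>}"
              using R_ge[of "2 * k + i"] by simp linarith
          qed
        qed simp
        show "f x \<inter> N (2 * j + i) = {}" if "x \<in> A (2 * k + i)" "k < j" for j k x
          using that by (intro later) auto
        show "open_colorable (A (2 * k + i)) f K" for k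
          using f by (intro K A_compact usc) (auto simp: A_def)
      qed (use A_compact N_open f usc in \<open>auto simp: A_def\<close>)
      have "bright_color euclidean X f (F p)" if "p \<in> I" for p
      proof -
        have "F p \<subseteq> X"
          using F(2)[of p] by (auto simp: A_def)
        then show ?thesis
          using F(1,4)[of p] that by (simp add: bright_color_def closed_subset I_def)
      qed
      then show ?thesis
        using F(3) unfolding I_def by blast
    qed
    then obtain F where F: "\<And>i p. p \<in> I \<Longrightarrow> bright_color euclidean X f (F i p)"
      "\<And>i. (\<Union>k. A (2 * k + i)) \<subseteq> (\<Union>p\<in>I. F i p)"
      by metis
    define \<F> where "\<F> = F 0 ` I \<union> F 1 ` I"
    have "X \<subseteq> \<Union>\<F>"
    proof
      fix x assume "x \<in> X"
      then obtain k where k: "x \<in> A k"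
        using A_cover by blast
      obtain i where i: "i = 0 \<or> i = 1" "k = 2 * (k div 2) + i"
        using mod_mult_div_eq[of k 2] by (metis add.commute not_mod_2_eq_1_eq_0)
      then have "x \<in> (\<Union>k. A (2 * k + i))"
        using k by (metis UNIV_I UN_I)
      then have "x \<in> (\<Union>p\<in>I. F i p)"
        using F(2)[of i] by blast
      with i(1) show "x \<in> \<Union>\<F>"
        unfolding \<F>_def by blast
    qed
    moreover have "card \<F> \<le> 2 * card I"
      unfolding \<F>_def
      using card_Un_le[of "F 0 ` I" "F 1 ` I"] card_image_le[OF \<open>finite I\<close>, of "F 0"]
        card_image_le[OF \<open>finite I\<close>, of "F 1"] by linarith
    moreover have "finite \<F>" "\<forall>B\<in>\<F>. bright_color euclidean X f B"
      using F(1) \<open>finite I\<close> by (auto simp: \<F>_def)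
    ultimately show ?thesis
      unfolding bright_colorable_def by blast
  qed
  then show ?thesis
    by blast
qed

end
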